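(* Let $d\geq 1$, let $G$ be a $d$--regular bipartite graph on $v(G)=2n$ vertices, and let $m_k(G)$ denote the number of matchings of size $k$ in $G$. Let $0\leq p\leq 1$. Then $$\sum_{k=0}^n m_k(G)\left(\frac{p}{d}\left(1-\frac{p}{d}\right)\right)^{k}(1-p)^{2(n-k)}\geq \left(1-\frac{p}{d}\right)^{nd}.$$
   Context: A matching of size $k$ is a set of $k$ pairwise vertex-disjoint edges; $m_0(G)=1$. The convention $0^0=1$ is used. *)

theory Defs
  imports Complex_Main
begin

definition simple_graph :: "'a set \<Rightarrow> 'a set set \<Rightarrow> bool" where
  "simple_graph V E \<longleftrightarrow> finite V \<and>
     (\<forall>e\<in>E. \<exists>u v. u \<in> V \<and> v \<in> V \<and> u \<noteq> v \<and> e = {u, v})"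

definition degree :: "'a set set \<Rightarrow> 'a \<Rightarrow> nat" where
  "degree E v = card {e \<in> E. v \<in> e}"

definition regular :: "nat \<Rightarrow> 'a set \<Rightarrow> 'a set set \<Rightarrow> bool" where
  "regular d V E \<longleftrightarrow> (\<forall>v\<in>V. degree E v = d)"

definition bipartite :: "'a set \<Rightarrow> 'a set set \<Rightarrow> bool" where
  "bipartite V E \<longleftrightarrow> (\<exists>A B. A \<union> B = V \<and> A \<inter> B = {} \<and>
     (\<forall>e\<in>E. \<exists>a b. a \<in> A \<and> b \<in> B \<and> e = {a, b}))"

definition matchings :: "'a set set \<Rightarrow> nat \<Rightarrow> 'a set set set" where
  "matchings E k = {M. M \<subseteq> E \<and> card M = k \<and> pairwise disjnt M}"

definition num_matchings :: "'a set set \<Rightarrow> nat \<Rightarrow> nat" where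
  "num_matchings E k = card (matchings E k)"

end

theory Submission
  imports Defs "HOL-Computational_Algebra.Fundamental_Theorem_Algebra"
begin

text \<open>
  The proof is a capacity argument in the style of Gurvits. Let \<open>A\<close>, \<open>B\<close> be the colour classes and put
  \<open>a = p/d (1 - p/d)\<close>, \<open>b = 1 - p\<close>. Applying the functionals \<open>f \<mapsto> b f(0) + a f'(0)\<close> in all the
  variables \<open>x v\<close> (\<open>v \<in> B\<close>) to \<open>\<Prod>u\<in>A. (b + \<Sum>v\<sim>u. x v)\<close> yields the sum in question. By AM--GM
  this product is at least \<open>(d/p) powr (p n) * (\<Prod>v\<in>B. x v) powr p\<close>. If the current polynomial, as a
  function of one variable \<open>t\<close>, is at least \<open>K t powr p\<close>, then the functional in that variable gives
  at least \<open>K (1 - p/d)^d (p/d) powr p\<close>; this holds because the degree in \<open>t\<close> is at most \<open>d\<close> and, by a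
  Heilmann--Lieb argument, all the roots in \<open>t\<close> are real and negative. The intermediate polynomials are
  matching sums of the subgraphs on \<open>A \<union> W\<close>, \<open>W \<subseteq> B\<close>, with vertex weights. The endpoints
  \<open>p = 0\<close> and \<open>p = 1\<close> follow by continuity.
\<close>

section \<open>Weighted matching sums\<close>

text \<open>\<open>S\<close> is the vertex set of an induced subgraph, so deleting vertices changes
  \<open>S\<close> alone and \<open>E\<close> stays fixed through every induction.\<close>

definition matchings_in :: "'a set set \<Rightarrow> 'a set \<Rightarrow> 'a set set set" where
  "matchings_in E S = {M. M \<subseteq> E \<and> pairwise disjnt M \<and> \<Union>M \<subseteq> S}"

text \<open>The matching polynomial with weight \<open>a\<close> per edge and \<open>z x\<close> per
  uncovered vertex. The ring is left general because real, complex and polynomial weights all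
  occur.\<close>

definition matching_sum :: "'a set set \<Rightarrow> 'r \<Rightarrow> 'a set \<Rightarrow> ('a \<Rightarrow> 'r) \<Rightarrow> 'r::comm_ring_1" where
  "matching_sum E a S z = (\<Sum>M\<in>matchings_in E S. a ^ card M * (\<Prod>x\<in>S - \<Union>M. z x))"

lemma finite_matchings_in: "finite S \<Longrightarrow> finite (matchings_in E S)"
  by (rule finite_subset[of _ "Pow (Pow S)"]) (auto simp: matchings_in_def)

lemma finite_matching: "finite S \<Longrightarrow> M \<in> matchings_in E S \<Longrightarrow> finite M"
  by (rule finite_subset[of _ "Pow S"]) (auto simp: matchings_in_def)

lemma matchings_in_covering:
  assumes E: "\<And>e. e \<in> E \<Longrightarrow> card e = 2" and v: "v \<in> S"
  shows "{M \<in> matchings_in E S. v \<in> \<Union>M} =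
    (\<Union>w\<in>{w \<in> S. {v, w} \<in> E}. insert {v, w} ` matchings_in E (S - {v, w}))"
    (is "?L = ?R")
proof (intro equalityI subsetI)
  fix M assume M: "M \<in> ?L"
  then obtain e where e: "e \<in> M" "v \<in> e" by auto
  with M have "e \<in> E" "e \<subseteq> S" by (auto simp: matchings_in_def)
  with E[of e] e obtain w where w: "e = {v, w}"
    by (metis card_2_iff doubleton_eq_iff insertE singletonD)
  have disj: "v \<notin> f \<and> w \<notin> f" if "f \<in> M" "f \<noteq> e" for f
  proof -
    have "disjnt f e" using M that e(1) by (simp add: matchings_in_def pairwise_def)
    then show ?thesis by (simp add: disjnt_def w)
  qed
  have "M - {e} \<in> matchings_in E (S - {v, w})"
  proof -
    have "M \<subseteq> E" "pairwise disjnt M" "\<Union>M \<subseteq> S" using M by (simp_all add: matchings_in_def)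
    then have "M - {e} \<subseteq> E" "pairwise disjnt (M - {e})" "\<Union>(M - {e}) \<subseteq> S - {v, w}"
      using disj by (blast, metis pairwise_subset Diff_subset, fast)
    then show ?thesis by (simp add: matchings_in_def)
  qed
  moreover have "M = insert {v, w} (M - {e})" using e w by auto
  ultimately show "M \<in> ?R" using \<open>e \<in> E\<close> \<open>e \<subseteq> S\<close> w by blast
next
  fix M assume "M \<in> ?R"
  then obtain w N where "w \<in> S" "{v, w} \<in> E" "N \<in> matchings_in E (S - {v, w})"
    "M = insert {v, w} N" by auto
  moreover from this have "disjnt {v, w} f \<and> disjnt f {v, w}" if "f \<in> N" for f
    using that unfolding matchings_in_def disjnt_def by blast
  ultimately show "M \<in> ?L" using v by (auto simp: matchings_in_def pairwise_insert)
qed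

text \<open>A matching either leaves \<open>v\<close> uncovered, which contributes
  \<open>z v\<close>, or pairs it with one neighbour \<open>w\<close>, which contributes
  \<open>a\<close>; the rest is a matching on the other vertices.\<close>

lemma matching_sum_recursion:
  assumes E: "\<And>e. e \<in> E \<Longrightarrow> card e = 2" and S: "finite S" "v \<in> S"
  shows "matching_sum E a S z = z v * matching_sum E a (S - {v}) z
    + a * (\<Sum>w | w \<in> S \<and> {v, w} \<in> E. matching_sum E a (S - {v, w}) z)"
proof -
  let ?t = "\<lambda>S M. a ^ card M * (\<Prod>x\<in>S - \<Union>M. z x)"
  let ?N = "{w \<in> S. {v, w} \<in> E}"
  have split: "matchings_in E S = matchings_in E (S - {v}) \<union> {M \<in> matchings_in E S. v \<in> \<Union>M}"
    by (auto simp: matchings_in_def)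
  have "matching_sum E a S z = (\<Sum>M\<in>matchings_in E (S - {v}). ?t S M)
      + (\<Sum>M | M \<in> matchings_in E S \<and> v \<in> \<Union>M. ?t S M)"
    unfolding matching_sum_def
    by (subst split, subst sum.union_disjoint)
       (auto simp: finite_matchings_in S, auto simp: matchings_in_def)
  also have "(\<Sum>M\<in>matchings_in E (S - {v}). ?t S M) = z v * matching_sum E a (S - {v}) z"
    unfolding matching_sum_def sum_distrib_left
  proof (rule sum.cong)
    fix M assume "M \<in> matchings_in E (S - {v})"
    then have "S - \<Union>M = insert v (S - {v} - \<Union>M)" using S by (auto simp: matchings_in_def)
    then show "?t S M = z v * ?t (S - {v}) M" using S
      by (simp add: mult.left_commute)
  qed simp
  also have "(\<Sum>M | M \<in> matchings_in E S \<and> v \<in> \<Union>M. ?t S M)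
      = (\<Sum>w\<in>?N. \<Sum>M\<in>insert {v, w} ` matchings_in E (S - {v, w}). ?t S M)"
  proof -
    \<comment> \<open>The images for different \<open>w\<close> are disjoint: the edges of
      \<open>M'\<close> avoid \<open>v\<close>, so \<open>{v, w'}\<close> is the only edge at
      \<open>v\<close>.\<close>
    have d: "insert {v, w} M \<noteq> insert {v, w'} M'"
      if "w \<noteq> w'" "M' \<in> matchings_in E (S - {v, w'})" for w w' M M'
    proof
      assume eq: "insert {v, w} M = insert {v, w'} M'"
      then have "{v, w} \<in> insert {v, w'} M'" by blast
      with that show False by (auto simp: matchings_in_def doubleton_eq_iff)
    qed
    have "{M \<in> matchings_in E S. v \<in> \<Union>M} =
        (\<Union>w\<in>?N. insert {v, w} ` matchings_in E (S - {v, w}))"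
      by (rule matchings_in_covering) (use E S in auto)
    moreover have "(\<Sum>M\<in>(\<Union>w\<in>?N. insert {v, w} ` matchings_in E (S - {v, w})). ?t S M)
        = (\<Sum>w\<in>?N. \<Sum>M\<in>insert {v, w} ` matchings_in E (S - {v, w}). ?t S M)"
      by (rule sum.UNION_disjoint) (use S d in \<open>auto simp: finite_matchings_in\<close>)
    ultimately show ?thesis by (simp only:)
  qed
  also have "\<dots> = (\<Sum>w\<in>?N. a * matching_sum E a (S - {v, w}) z)"
  proof (rule sum.cong)
    fix w assume w: "w \<in> ?N"
    have notin: "{v, w} \<notin> M" if "M \<in> matchings_in E (S - {v, w})" for M
      using that by (auto simp: matchings_in_def)
    have "(\<Sum>M\<in>insert {v, w} ` matchings_in E (S - {v, w}). ?t S M)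
        = (\<Sum>M\<in>matchings_in E (S - {v, w}). ?t S (insert {v, w} M))"
      by (subst sum.reindex) (use notin in \<open>auto simp: inj_on_def insert_ident\<close>)
    also have "\<dots> = a * matching_sum E a (S - {v, w}) z"
      unfolding matching_sum_def sum_distrib_left
    proof (rule sum.cong)
      fix M assume M: "M \<in> matchings_in E (S - {v, w})"
      have "finite M" using M S finite_matching[of "S - {v, w}"] by auto
      moreover have "S - \<Union>(insert {v, w} M) = S - {v, w} - \<Union>M" by auto
      ultimately show "?t S (insert {v, w} M) = a * ?t (S - {v, w}) M"
        using notin[OF M] by (simp add: mult.assoc)
    qed simp
    finally show "(\<Sum>M\<in>insert {v, w} ` matchings_in E (S - {v, w}). ?t S M)
        = a * matching_sum E a (S - {v, w}) z" .
  qed simp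
  finally show ?thesis by (simp add: sum_distrib_left)
qed

lemma matching_sum_cong:
  "(\<And>x. x \<in> S \<Longrightarrow> z x = z' x) \<Longrightarrow> matching_sum E a S z = matching_sum E a S z'"
  unfolding matching_sum_def by (intro sum.cong arg_cong2[where f = "(*)"] prod.cong) auto

lemma matching_sum_of_real:
  "matching_sum E (of_real a) S (\<lambda>x. of_real (z x)) =
    (of_real (matching_sum E a S z) :: 'r::{comm_ring_1, real_algebra_1})"
  by (simp add: matching_sum_def)

lemma matching_sum_no_edges:
  assumes "\<And>e. e \<in> E \<Longrightarrow> \<not> e \<subseteq> S"
  shows "matching_sum E a S z = (\<Prod>x\<in>S. z x)"
proof -
  have "matchings_in E S = {{}}" using assms by (fastforce simp: matchings_in_def)
  then show ?thesis by (simp add: matching_sum_def)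
qed

lemma matching_sum_pos:
  fixes z :: "'a \<Rightarrow> real"
  assumes "finite S" "0 \<le> a" "\<And>x. x \<in> S \<Longrightarrow> 0 < z x"
  shows "0 < matching_sum E a S z"
  unfolding matching_sum_def
proof (rule sum_pos2)
  show "{} \<in> matchings_in E S" by (auto simp: matchings_in_def)
  show "0 < a ^ card {} * (\<Prod>x\<in>S - \<Union>{}. z x)" using assms by (simp add: prod_pos)
  show "0 \<le> a ^ card M * (\<Prod>x\<in>S - \<Union>M. z x)" for M
    using assms by (intro mult_nonneg_nonneg prod_nonneg) (auto simp: less_imp_le)
qed (simp add: finite_matchings_in assms)

section \<open>Zeros of matching sums\<close>

lemma Re_complex_of_real_mult: "Re (of_real a * r) = a * Re r"
  by simp

lemma complex_Re_inverse_pos: "0 < Re r \<Longrightarrow> 0 < Re (inverse r)"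
  by (simp add: add_pos_nonneg)

text \<open>The ratio is what makes the Heilmann--Lieb induction work: by the recursion at \<open>x\<close> it is
  \<open>z x\<close> plus reciprocals of such ratios for smaller sets. For a bipartite graph, \<open>g\<close> rotates
  the half-planes of the two colour classes in opposite directions.\<close>

lemma matching_sum_ratio:
  fixes z g :: "'a \<Rightarrow> complex"
  assumes E: "\<And>e. e \<in> E \<Longrightarrow> card e = 2" and S: "finite S" and a: "0 \<le> a"
    and g: "\<And>x y. {x, y} \<in> E \<Longrightarrow> g x * g y = 1"
    and z: "\<And>x. x \<in> S \<Longrightarrow> 0 < Re (g x * z x)"
  shows "matching_sum E (of_real a) S z \<noteq> 0 \<and>
    (\<forall>x\<in>S. 0 < Re (g x * matching_sum E (of_real a) S z / matching_sum E (of_real a) (S - {x}) z))"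
  using S z
proof (induction "card S" arbitrary: S rule: less_induct)
  case less
  let ?Z = "\<lambda>S. matching_sum E (of_real a) S z"
  have ratio: "0 < Re (g x * ?Z S / ?Z (S - {x}))" if x: "x \<in> S" for x
  proof -
    have lt: "card (S - {x}) < card S" using x less.prems(1) by (rule card_Diff1_less[rotated])
    note IH = less.hyps[OF lt]
    have nz: "?Z (S - {x}) \<noteq> 0" using IH less.prems by auto
    let ?N = "{w \<in> S. {x, w} \<in> E}"
    have "g x * ?Z S / ?Z (S - {x}) =
        g x * z x + of_real a * (\<Sum>w\<in>?N. g x * ?Z (S - {x, w}) / ?Z (S - {x}))"
      using nz by (simp add: matching_sum_recursion[OF E less.prems(1) x] field_simps sum_distrib_left
          flip: sum_divide_distrib)
    moreover have "0 \<le> Re (g x * ?Z (S - {x, w}) / ?Z (S - {x}))" if w: "w \<in> ?N" for w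
    proof -
      have "w \<noteq> x" using E[of "{x, w}"] w by auto
      moreover have "S - {x, w} = S - {x} - {w}" by auto
      ultimately have r: "0 < Re (g w * ?Z (S - {x}) / ?Z (S - {x, w}))"
        using IH less.prems w by auto
      \<comment> \<open>The condition on \<open>g\<close> turns the term into the reciprocal of the
        ratio at \<open>w\<close> for \<open>S - {x}\<close>, and inversion preserves the open right
        half-plane.\<close>
      have "g x = inverse (g w)" using g[of x w] w
        by (metis (mono_tags, lifting) inverse_unique mem_Collect_eq mult.commute)
      then have "g x * ?Z (S - {x, w}) / ?Z (S - {x}) = inverse (g w * ?Z (S - {x}) / ?Z (S - {x, w}))"
        by (simp add: divide_simps)
      then show ?thesis using r by (metis complex_Re_inverse_pos less_imp_le)
    qed
    ultimately show ?thesis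
      using less.prems(2)[OF x] a
      by (simp only: Re_complex_of_real_mult plus_complex.sel Re_sum)
         (intro add_pos_nonneg mult_nonneg_nonneg sum_nonneg; blast)
  qed
  moreover have "?Z S \<noteq> 0"
  proof (cases "S = {}")
    case True
    then show ?thesis using E by (subst matching_sum_no_edges) fastforce+
  next
    case False
    then show ?thesis using ratio by fastforce
  qed
  ultimately show ?case by blast
qed

section \<open>Matching sums as polynomials in one variable\<close>

lemma poly_matching_sum:
  "poly (matching_sum E [:a:] S q) t = matching_sum E a S (\<lambda>x. poly (q x) t)"
  by (simp add: matching_sum_def poly_sum poly_prod)

text \<open>Roots are located over the complex numbers, while the capacity bound concerns a real
  polynomial; this links the two.\<close>

lemma map_poly_matching_sum:
  "map_poly of_real (matching_sum E [:a:] S (\<lambda>x. [:c x, \<delta> x:])) =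
    (matching_sum E [:of_real a:] S (\<lambda>x. [:of_real (c x), of_real (\<delta> x):]) :: complex poly)"
proof -
  have mult: "map_poly complex_of_real (q * r) = map_poly of_real q * map_poly of_real r" for q r
    by (simp add: poly_eq_iff coeff_map_poly coeff_mult)
  have prod: "map_poly complex_of_real (\<Prod>x\<in>T. [:c x, \<delta> x:]) = (\<Prod>x\<in>T. [:of_real (c x), of_real (\<delta> x):])" for T
  proof (induction T rule: infinite_finite_induct)
    case (insert x T)
    then show ?case
      by (simp add: mult map_poly_pCons del: mult_pCons_left)
  qed simp_all
  have sum: "map_poly complex_of_real (\<Sum>i\<in>I. F i) = (\<Sum>i\<in>I. map_poly of_real (F i))" for F and I :: "'a set set set"
    by (simp add: poly_eq_iff coeff_map_poly coeff_sum)
  show ?thesis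
    by (simp add: matching_sum_def sum mult prod poly_const_pow map_poly_pCons del: mult_pCons_left)
qed

lemma coeff_1_prod_linear:
  fixes c \<delta> :: "'a \<Rightarrow> 'r::idom"
  assumes "finite T"
  shows "coeff (\<Prod>x\<in>T. [:c x, \<delta> x:]) 1 = (\<Sum>x\<in>T. \<delta> x * (\<Prod>y\<in>T - {x}. c y))"
  using assms
proof (induction T rule: finite_induct)
  case (insert v T)
  have "coeff (\<Prod>x\<in>T. [:c x, \<delta> x:]) 0 = (\<Prod>x\<in>T. c x)"
    by (simp add: poly_prod flip: poly_0_coeff_0)
  moreover have "(\<Sum>x\<in>T. \<delta> x * (\<Prod>y\<in>insert v T - {x}. c y))
      = (\<Sum>x\<in>T. c v * (\<delta> x * (\<Prod>y\<in>T - {x}. c y)))"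
  proof (rule sum.cong)
    fix x assume "x \<in> T"
    then have "insert v T - {x} = insert v (T - {x})" using insert by auto
    then show "\<delta> x * (\<Prod>y\<in>insert v T - {x}. c y) = c v * (\<delta> x * (\<Prod>y\<in>T - {x}. c y))"
      using insert by (simp add: mult.left_commute)
  qed simp
  ultimately show ?case
    using insert by (simp add: sum_distrib_left)
qed simp

text \<open>Differentiating the factor of an uncovered vertex \<open>x\<close> at 0 gives
  \<open>\<delta> x\<close> and leaves a matching that avoids \<open>x\<close>; exchanging the sums
  collects these by \<open>x\<close>. In the elimination of a variable this becomes the edge part of
  \<open>matching_sum_recursion\<close>.\<close>

lemma coeff_1_matching_sum:
  fixes c \<delta> :: "'a \<Rightarrow> 'r::idom"
  assumes S: "finite S"
  shows "coeff (matching_sum E [:a:] S (\<lambda>x. [:c x, \<delta> x:])) 1 =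
    (\<Sum>x\<in>S. \<delta> x * matching_sum E a (S - {x}) c)"
proof -
  have "coeff (matching_sum E [:a:] S (\<lambda>x. [:c x, \<delta> x:])) 1 =
    (\<Sum>M\<in>matchings_in E S. \<Sum>x | x \<in> S \<and> x \<in> S - \<Union>M. a ^ card M * (\<delta> x * (\<Prod>y\<in>S - \<Union>M - {x}. c y)))"
    unfolding matching_sum_def coeff_sum
  proof (rule sum.cong)
    fix M :: "'a set set"
    have "[:a:] ^ card M = [:a ^ card M:]" by (simp add: poly_const_pow)
    then have "coeff ([:a:] ^ card M * (\<Prod>x\<in>S - \<Union>M. [:c x, \<delta> x:])) 1
        = a ^ card M * (\<Sum>x\<in>S - \<Union>M. \<delta> x * (\<Prod>y\<in>S - \<Union>M - {x}. c y))"
      using coeff_1_prod_linear[of "S - \<Union>M" c \<delta>] S by simp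
    then show "coeff ([:a:] ^ card M * (\<Prod>x\<in>S - \<Union>M. [:c x, \<delta> x:])) 1
        = (\<Sum>x | x \<in> S \<and> x \<in> S - \<Union>M. a ^ card M * (\<delta> x * (\<Prod>y\<in>S - \<Union>M - {x}. c y)))"
      by (simp add: sum_distrib_left set_diff_eq)
  qed simp
  also have "\<dots> = (\<Sum>x\<in>S. \<Sum>M | M \<in> matchings_in E S \<and> x \<in> S - \<Union>M.
      a ^ card M * (\<delta> x * (\<Prod>y\<in>S - \<Union>M - {x}. c y)))"
    by (rule sum.swap_restrict) (auto simp: S finite_matchings_in)
  also have "\<dots> = (\<Sum>x\<in>S. \<delta> x * matching_sum E a (S - {x}) c)"
  proof (rule sum.cong)
    fix x assume "x \<in> S"
    then have "{M \<in> matchings_in E S. x \<in> S - \<Union>M} = matchings_in E (S - {x})"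
      by (auto simp: matchings_in_def)
    moreover have "S - \<Union>M - {x} = S - {x} - \<Union>M" for M by auto
    ultimately show "(\<Sum>M | M \<in> matchings_in E S \<and> x \<in> S - \<Union>M.
      a ^ card M * (\<delta> x * (\<Prod>y\<in>S - \<Union>M - {x}. c y))) = \<delta> x * matching_sum E a (S - {x}) c"
      by (simp add: matching_sum_def sum_distrib_left mult.left_commute)
  qed simp
  finally show ?thesis .
qed

text \<open>When the variable of \<open>v\<close> is eliminated, the vertices counted here are the
  neighbours of \<open>v\<close>, so the degree is at most \<open>d\<close>.\<close>

lemma degree_matching_sum_le:
  fixes c \<delta> :: "'a \<Rightarrow> 'r::idom"
  assumes S: "finite S"
  shows "Polynomial.degree (matching_sum E [:a:] S (\<lambda>x. [:c x, \<delta> x:])) \<le> card {x \<in> S. \<delta> x \<noteq> 0}"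
  unfolding matching_sum_def
proof (rule degree_sum_le)
  fix M
  have "Polynomial.degree (\<Prod>x\<in>S - \<Union>M. [:c x, \<delta> x:])
      \<le> (\<Sum>x\<in>S - \<Union>M. Polynomial.degree [:c x, \<delta> x:])"
    using degree_prod_sum_le[of "S - \<Union>M" "\<lambda>x. [:c x, \<delta> x:]"] S by (simp add: o_def)
  also have "\<dots> \<le> (\<Sum>x\<in>S. Polynomial.degree [:c x, \<delta> x:])"
    using S by (intro sum_mono2) auto
  also have "\<dots> = card {x \<in> S. \<delta> x \<noteq> 0}"
    using S by (simp add: if_distrib sum.If_cases Int_def cong: if_cong)
  finally have "Polynomial.degree (\<Prod>x\<in>S - \<Union>M. [:c x, \<delta> x:]) \<le> card {x \<in> S. \<delta> x \<noteq> 0}" .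
  moreover have "Polynomial.degree ([:a:] ^ card M * (\<Prod>x\<in>S - \<Union>M. [:c x, \<delta> x:])) \<le>
      Polynomial.degree (\<Prod>x\<in>S - \<Union>M. [:c x, \<delta> x:])"
    by (simp add: poly_const_pow degree_smult_le)
  ultimately show "Polynomial.degree ([:a:] ^ card M * (\<Prod>x\<in>S - \<Union>M. [:c x, \<delta> x:]))
      \<le> card {x \<in> S. \<delta> x \<noteq> 0}" by linarith
qed (simp add: finite_matchings_in S)

text \<open>For nonreal \<open>t\<close>, multiplying the weights on \<open>A\<close> by
  \<open>h\<close> and the others by \<open>inverse h\<close> puts all of them in the right
  half-plane: the slope term on \<open>A\<close> becomes imaginary, and off \<open>A\<close> the
  weights are positive constants. So \<open>matching_sum_ratio\<close> excludes a zero. For real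
  \<open>t \<ge> 0\<close> all weights are positive, and so is the sum.\<close>

lemma matching_sum_roots:
  fixes c \<delta> :: "'a \<Rightarrow> real" and t :: complex
  assumes E: "\<And>e. e \<in> E \<Longrightarrow> card e = 2" and S: "finite S" and a: "0 \<le> a"
    and bip: "\<And>x y. {x, y} \<in> E \<Longrightarrow> x \<in> A \<longleftrightarrow> y \<notin> A"
    and c: "\<And>x. x \<in> S \<Longrightarrow> 0 < c x"
    and \<delta>: "\<And>x. x \<in> S \<Longrightarrow> 0 \<le> \<delta> x" "\<And>x. x \<in> S - A \<Longrightarrow> \<delta> x = 0"
    and root: "matching_sum E (of_real a) S (\<lambda>x. of_real (c x) + t * of_real (\<delta> x)) = 0"
  shows "t \<in> \<real> \<and> Re t < 0"
proof -
  have "Im t = 0"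
  proof (rule ccontr)
    assume t: "Im t \<noteq> 0"
    \<comment> \<open>chosen so that \<open>Re h = 1\<close> and \<open>Re (h * t) = 0\<close>\<close>
    define h where "h = Complex 1 (Re t / Im t)"
    define g where "g x = (if x \<in> A then h else inverse h)" for x
    have h: "h \<noteq> 0" by (simp add: h_def complex_eq_iff)
    have "matching_sum E (of_real a) S (\<lambda>x. of_real (c x) + t * of_real (\<delta> x)) \<noteq> 0"
    proof (rule matching_sum_ratio[where g = g, THEN conjunct1])
      show "g x * g y = 1" if "{x, y} \<in> E" for x y
        using bip[OF that] h by (auto simp: g_def)
      show "0 < Re (g x * (complex_of_real (c x) + t * complex_of_real (\<delta> x)))" if x: "x \<in> S" for x
      proof (cases "x \<in> A")
        case True
        have "Re (h * (complex_of_real (c x) + t * complex_of_real (\<delta> x))) = c x"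
          using t by (simp add: h_def field_simps)
        then show ?thesis using c[OF x] True by (simp add: g_def del: times_complex.sel)
      next
        case False
        then have "Re (g x * (complex_of_real (c x) + t * complex_of_real (\<delta> x))) = c x * Re (inverse h)"
          using \<delta>(2)[of x] x by (simp add: g_def)
        moreover have "0 < Re (inverse h)" by (simp add: h_def add_pos_nonneg)
        ultimately show ?thesis using c[OF x] by (simp only: mult_pos_pos)
      qed
    qed (use E S a in auto)
    then show False using root by simp
  qed
  then have t: "t = of_real (Re t)" by (simp add: complex_eq_iff)
  have "matching_sum E a S (\<lambda>x. c x + Re t * \<delta> x) = 0"
    using root matching_sum_of_real[of E a S "\<lambda>x. c x + Re t * \<delta> x", where 'r = complex]
    by (subst (asm) t) simp
  moreover have "0 < matching_sum E a S (\<lambda>x. c x + Re t * \<delta> x)" if "0 \<le> Re t"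
    using S a c \<delta>(1) that by (intro matching_sum_pos add_pos_nonneg mult_nonneg_nonneg) auto
  ultimately show ?thesis using t by (metis Reals_of_real less_irrefl not_le)
qed

section \<open>The capacity inequality\<close>

text \<open>A root \<open>r < 0\<close> splits off \<open>t - r = - r * (1 + \<alpha> * t)\<close>
  with \<open>\<alpha> = - 1 / r\<close>. Since all factors have constant term 1, the remaining
  scalar is the value at 0.\<close>

lemma complex_poly_neg_roots_factorization:
  fixes F :: "complex poly"
  assumes "\<And>z. poly F z = 0 \<Longrightarrow> z \<in> \<real> \<and> Re z < 0"
  shows "\<exists>\<alpha>s::real list. length \<alpha>s = Polynomial.degree F \<and> (\<forall>\<alpha>\<in>set \<alpha>s. 0 \<le> \<alpha>) \<and>
    F = smult (poly F 0) (\<Prod>\<alpha>\<leftarrow>\<alpha>s. [:1, of_real \<alpha>:])"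
  using assms
proof (induction "Polynomial.degree F" arbitrary: F)
  case 0
  then obtain c where "F = [:c:]" by (metis degree_0_id degree_eq_zeroE)
  then show ?case by (intro exI[of _ "[]"]) simp
next
  case (Suc k)
  then have "\<not> constant (poly F)" by (simp add: constant_degree)
  then obtain w where w: "poly F w = 0" using fundamental_theorem_of_algebra by blast
  then obtain r where r: "w = of_real r" "r < 0" using Suc.prems[OF w] by (metis Re_complex_of_real Reals_cases)
  obtain G where G: "F = [:-w, 1:] * G" using w by (auto simp: poly_eq_0_iff_dvd)
  have "G \<noteq> 0" using Suc.hyps(2) G by auto
  then have "Polynomial.degree F = Suc (Polynomial.degree G)"
    unfolding G by (subst degree_mult_eq) auto
  then have deg: "k = Polynomial.degree G" using Suc.hyps(2) by simp
  have "\<And>z. poly G z = 0 \<Longrightarrow> z \<in> \<real> \<and> Re z < 0" using Suc.prems G by simp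
  from Suc.hyps(1)[OF deg this] obtain \<alpha>s :: "real list" where \<alpha>s: "length \<alpha>s = k" "\<forall>\<alpha>\<in>set \<alpha>s. 0 \<le> \<alpha>"
    "G = smult (poly G 0) (\<Prod>\<alpha>\<leftarrow>\<alpha>s. [:1, of_real \<alpha>:])" using deg by auto
  have "[:-w, 1:] = smult (-w) [:1, of_real (- 1 / r):]" using r by simp
  then have "F = smult (poly F 0) (\<Prod>\<alpha>\<leftarrow>(- 1 / r) # \<alpha>s. [:1, of_real \<alpha>:])"
    by (subst G, subst \<alpha>s(3)) (use r in \<open>simp add: G smult_diff_right smult_add_right mult_ac\<close>)
  then show ?case using \<alpha>s r Suc.hyps(2)
    by (intro exI[of _ "(- 1 / r) # \<alpha>s"]) auto
qed

text \<open>AM-GM for the factors, padded with ones to \<open>d\<close> of them; \<open>Y\<close> in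
  the proof is the mean of the padded list.\<close>

lemma prod_list_linear_le_power:
  fixes \<alpha>s :: "real list"
  assumes len: "length \<alpha>s \<le> d" and d: "0 < d" and nonneg: "\<forall>\<alpha>\<in>set \<alpha>s. 0 \<le> \<alpha>" and t: "0 \<le> t"
  shows "(\<Prod>\<alpha>\<leftarrow>\<alpha>s. 1 + \<alpha> * t) \<le> (1 + sum_list \<alpha>s * t / d) ^ d"
proof -
  define Y where "Y = 1 + sum_list \<alpha>s * t / d"
  have Y: "0 < Y" unfolding Y_def using nonneg t by (simp add: add_pos_nonneg sum_list_nonneg)
  \<comment> \<open>The tangent bound for \<open>exp\<close>, scaled to be sharp at
    \<open>y = Y\<close>. Multiplied over the padded list, the exponents add up to 0.\<close>
  have le_exp: "y \<le> Y * exp (y / Y - 1)" for y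
    using exp_ge_add_one_self[of "y / Y - 1"] Y by (simp add: field_simps)
  have "(\<Prod>\<alpha>\<leftarrow>\<alpha>s. 1 + \<alpha> * t) \<le>
      Y ^ length \<alpha>s * exp ((length \<alpha>s + sum_list \<alpha>s * t) / Y - length \<alpha>s)"
    using nonneg
  proof (induction \<alpha>s)
    case (Cons \<alpha> \<alpha>s)
    have "(\<Prod>\<alpha>\<leftarrow>\<alpha> # \<alpha>s. 1 + \<alpha> * t) \<le> (Y * exp ((1 + \<alpha> * t) / Y - 1)) *
       (Y ^ length \<alpha>s * exp ((length \<alpha>s + sum_list \<alpha>s * t) / Y - length \<alpha>s))"
      unfolding list.map prod_list.Cons using Cons t Y
      by (intro mult_mono le_exp Cons.IH prod_list_nonneg) auto
    also have "\<dots> = Y ^ length (\<alpha> # \<alpha>s) *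
        exp (((1 + \<alpha> * t) / Y - 1) + ((length \<alpha>s + sum_list \<alpha>s * t) / Y - length \<alpha>s))"
      by (simp add: exp_add)
    also have "((1 + \<alpha> * t) / Y - 1) + ((length \<alpha>s + sum_list \<alpha>s * t) / Y - length \<alpha>s) =
        (length (\<alpha> # \<alpha>s) + sum_list (\<alpha> # \<alpha>s) * t) / Y - length (\<alpha> # \<alpha>s)"
      by (simp add: add_divide_distrib algebra_simps)
    finally show ?case .
  qed simp
  also have "(length \<alpha>s + sum_list \<alpha>s * t) / Y - length \<alpha>s = real (d - length \<alpha>s) * (1 - 1 / Y)"
  proof -
    have "sum_list \<alpha>s * t = d * (Y - 1)" using d by (simp add: Y_def)
    then show ?thesis using Y len by (simp add: of_nat_diff field_simps)
  qed
  also have "Y ^ length \<alpha>s * exp (real (d - length \<alpha>s) * (1 - 1 / Y)) \<le>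
      Y ^ length \<alpha>s * Y ^ (d - length \<alpha>s)"
  proof -
    \<comment> \<open>This is \<open>le_exp\<close> at \<open>y = 1\<close>, the bound for one
      padding factor.\<close>
    have "exp (1 - 1 / Y) \<le> Y"
      using mult_left_mono[OF le_exp[of 1], of "exp (1 - 1 / Y)"] Y
      by (simp add: mult.left_commute flip: exp_add)
    then show ?thesis using Y
      by (auto simp: exp_of_nat_mult intro!: mult_left_mono power_mono)
  qed
  finally show ?thesis using len by (simp add: Y_def flip: power_add)
qed

text \<open>In the factorisation, \<open>coeff f 1 / coeff f 0\<close> is the sum of the
  \<open>\<alpha>s\<close>, so AM-GM bounds \<open>f\<close> by its first two coefficients.\<close>

lemma poly_le_power_of_neg_roots:
  fixes f :: "real poly"
  assumes roots: "\<And>z::complex. poly (map_poly of_real f) z = 0 \<Longrightarrow> z \<in> \<real> \<and> Re z < 0"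
    and deg: "Polynomial.degree f \<le> d" "0 < d" and f0: "0 < coeff f 0" and t: "0 \<le> t"
  shows "poly f t \<le> coeff f 0 * (1 + coeff f 1 / coeff f 0 * t / d) ^ d"
proof -
  let ?F = "map_poly complex_of_real f"
  obtain \<alpha>s :: "real list" where \<alpha>s: "length \<alpha>s = Polynomial.degree ?F" "\<forall>\<alpha>\<in>set \<alpha>s. 0 \<le> \<alpha>"
    and F: "?F = smult (poly ?F 0) (\<Prod>\<alpha>\<leftarrow>\<alpha>s. [:1, of_real \<alpha>:])"
    using complex_poly_neg_roots_factorization[of ?F] roots by blast
  have len: "length \<alpha>s \<le> d" using \<alpha>s deg by (simp add: degree_map_poly)
  define P where "P = (\<Prod>\<alpha>\<leftarrow>\<alpha>s. [:1, \<alpha>:])"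
  have "(\<Prod>\<alpha>\<leftarrow>\<beta>s. [:1, of_real \<alpha>:]) = map_poly complex_of_real (\<Prod>\<alpha>\<leftarrow>\<beta>s. [:1, \<alpha>:])" for \<beta>s
    by (induction \<beta>s) (simp_all add: poly_eq_iff coeff_map_poly coeff_pCons split: nat.split)
  then have "?F = map_poly complex_of_real (smult (coeff f 0) P)"
    by (subst F) (simp add: P_def poly_eq_iff coeff_map_poly poly_0_coeff_0)
  \<comment> \<open>The \<open>\<alpha>s\<close> are real, so comparing coefficients brings the
    factorisation back to the reals.\<close>
  then have "complex_of_real (coeff f n) = of_real (coeff (smult (coeff f 0) P) n)" for n
    by (metis coeff_map_poly of_real_0)
  then have f: "f = smult (coeff f 0) P"
    unfolding poly_eq_iff of_real_eq_iff by blast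
  have P: "poly P t = (\<Prod>\<alpha>\<leftarrow>\<alpha>s. 1 + \<alpha> * t)"
    unfolding P_def by (induction \<alpha>s) (simp_all add: algebra_simps)
  have "coeff (\<Prod>\<alpha>\<leftarrow>\<beta>s. [:1, \<alpha>:]) 0 = 1 \<and> coeff (\<Prod>\<alpha>\<leftarrow>\<beta>s. [:1, \<alpha>:]) 1 = sum_list \<beta>s" for \<beta>s :: "real list"
    by (induction \<beta>s) (simp_all add: coeff_pCons split: nat.split)
  then have "coeff f 1 = coeff f 0 * sum_list \<alpha>s" by (subst f) (simp add: P_def)
  then have s: "coeff f 1 / coeff f 0 = sum_list \<alpha>s" using f0 by simp
  show ?thesis
    unfolding s using prod_list_linear_le_power[OF len deg(2) \<alpha>s(2) t] f0
    by (subst f) (simp add: P mult_left_mono)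
qed

section \<open>Weighted AM-GM and the one-variable step\<close>

text \<open>Weighted AM-GM for the values \<open>exp (l i)\<close>, with the leftover weight on the
  value 1. The tangent to \<open>exp\<close> at the mean \<open>L\<close> lies below the curve, and
  its weighted average is exactly \<open>exp L\<close>.\<close>

lemma weighted_exp_mean:
  fixes w l :: "'a \<Rightarrow> real"
  assumes w: "\<And>i. i \<in> N \<Longrightarrow> 0 \<le> w i" "sum w N \<le> 1"
  shows "exp (\<Sum>i\<in>N. w i * l i) \<le> (1 - sum w N) + (\<Sum>i\<in>N. w i * exp (l i))"
proof -
  define L where "L = (\<Sum>i\<in>N. w i * l i)"
  have tangent: "exp L * (1 + y - L) \<le> exp y" for y
    using mult_left_mono[OF exp_ge_add_one_self[of "y - L"], of "exp L"]
    by (simp add: algebra_simps flip: exp_add)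
  have "exp L = (1 - sum w N) * (exp L * (1 + 0 - L)) + (\<Sum>i\<in>N. w i * (exp L * (1 + l i - L)))"
    by (simp add: algebra_simps sum.distrib sum_subtractf flip: sum_distrib_left sum_distrib_right)
       (simp add: L_def mult.commute algebra_simps flip: sum_distrib_left)
  also have "\<dots> \<le> (1 - sum w N) * exp 0 + (\<Sum>i\<in>N. w i * exp (l i))"
    using w by (intro add_mono sum_mono mult_left_mono tangent) auto
  finally show ?thesis by (simp add: L_def)
qed

lemma powr_le_affine:
  fixes y p :: real
  assumes "0 < y" "0 \<le> p" "p \<le> 1"
  shows "y powr p \<le> 1 - p + p * y"
  using weighted_exp_mean[of "{()}" "\<lambda>_. p" "\<lambda>_. ln y"] assms by (simp add: powr_def)

text \<open>\<open>cap\<close> is a lower bound \<open>K * t powr p\<close> at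
  \<open>t = exp s\<close>. Comparing it at a single \<open>t\<close> with the upper bound from the
  first two coefficients bounds \<open>K\<close>; concavity of the power then makes that bound
  linear in the coefficients.\<close>

lemma capacity_step:
  fixes f :: "real poly" and p K :: real
  assumes roots: "\<And>z::complex. poly (map_poly of_real f) z = 0 \<Longrightarrow> z \<in> \<real> \<and> Re z < 0"
    and deg: "Polynomial.degree f \<le> d" "0 < d"
    and pos: "0 < coeff f 0" "0 < coeff f 1" and p: "0 < p" "p < 1"
    and cap: "\<And>s. K * exp (p * s) \<le> poly f (exp s)"
  shows "K * ((1 - p / d) ^ d * (p / d) powr p)
    \<le> (1 - p) * coeff f 0 + p / d * (1 - p / d) * coeff f 1"
proof -
  define q where "q = 1 - p / d"
  define s where "s = coeff f 1 / coeff f 0 / d"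
  \<comment> \<open>the minimiser of \<open>(1 + s * t) ^ d / t powr p\<close>\<close>
  define t where "t = p / d / q / s"
  have "p < d" using p deg by (metis less_trans of_nat_1 of_nat_le_iff less_le_trans Suc_leI One_nat_def)
  then have q: "0 < q" using deg by (simp add: q_def)
  have s: "0 < s" using pos deg by (simp add: s_def)
  have t: "0 < t" using q s p deg by (simp add: t_def)
  have "K * t powr p \<le> poly f t" using cap[of "ln t"] t by (simp add: powr_def)
  also have "\<dots> \<le> coeff f 0 * (1 + s * t) ^ d"
    using poly_le_power_of_neg_roots[OF roots deg pos(1), of t] t by (simp add: s_def)
  \<comment> \<open>The choice of \<open>t\<close> gives \<open>s * t = (1 - q) / q\<close>, so the
    coefficients of \<open>f\<close> drop out of the base.\<close>
  also have "1 + s * t = 1 / q" using s q by (simp add: t_def field_simps) (simp add: q_def)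
  finally have "K * t powr p * q ^ d \<le> coeff f 0"
    using q by (simp add: power_divide field_simps)
  then have "K * t powr p * q ^ d * (q * s) powr p \<le> coeff f 0 * (q * s) powr p"
    by (rule mult_right_mono) simp
  also have "K * t powr p * q ^ d * (q * s) powr p = K * (q ^ d * (p / d) powr p)"
  proof -
    have "t powr p * (q * s) powr p = (p / d) powr p"
      using t q s by (simp add: t_def flip: powr_mult)
    then show ?thesis by (simp add: mult_ac)
  qed
  \<comment> \<open>The power is replaced by its tangent at 1. As \<open>s\<close> is
    \<open>coeff f 1 / coeff f 0 / d\<close>, the functional of the conclusion appears.\<close>
  also have "coeff f 0 * (q * s) powr p \<le> coeff f 0 * (1 - p + p * (q * s))"
    using powr_le_affine[of "q * s" p] q s p pos by (intro mult_left_mono) auto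
  also have "\<dots> = (1 - p) * coeff f 0 + p / d * q * coeff f 1"
    using pos deg by (simp add: s_def field_simps)
  finally show ?thesis by (simp add: q_def)
qed

section \<open>Elimination of the variables\<close>

text \<open>\<open>W\<close> holds the vertices of \<open>B\<close> whose variables have been
  eliminated; they have joined the graph with weight \<open>1 - p\<close>. The remaining variables
  are written \<open>exp (l v)\<close>, which keeps them positive and makes the exponent of their
  monomial linear in \<open>l\<close>.\<close>

lemma matching_sum_capacity:
  fixes A B :: "'a set" and l :: "'a \<Rightarrow> real" and p :: real
  assumes fin: "finite A" "finite B" and disj: "A \<inter> B = {}"
    and E: "\<And>e. e \<in> E \<Longrightarrow> \<exists>u\<in>A. \<exists>v\<in>B. e = {u, v}"
    and regA: "\<And>u. u \<in> A \<Longrightarrow> card {v \<in> B. {u, v} \<in> E} = d"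
    and regB: "\<And>v. v \<in> B \<Longrightarrow> card {u \<in> A. {u, v} \<in> E} = d"
    and d: "0 < d" and p: "0 < p" "p < 1" and W: "W \<subseteq> B"
  shows "(d / p) powr (p * card A) * ((1 - p / d) ^ d * (p / d) powr p) ^ card W
      * exp (p * (\<Sum>v\<in>B - W. l v))
    \<le> matching_sum E (p / d * (1 - p / d)) (A \<union> W)
        (\<lambda>x. 1 - p + (if x \<in> A then \<Sum>v | v \<in> B - W \<and> {x, v} \<in> E. exp (l v) else 0))"
proof -
  define a where "a = p / d * (1 - p / d)"
  define wt where "wt W l x = 1 - p + (if x \<in> A then \<Sum>v | v \<in> B - W \<and> {x, v} \<in> E. exp (l v) else 0)"
    for W l x
  define C where "C = (1 - p / d) ^ d * (p / d) powr p"
  have a: "0 \<le> a" using p d by (simp add: a_def)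
  have card2: "card e = 2" if "e \<in> E" for e
    using E[OF that] disj by (auto simp: card_insert_if)
  have bip: "x \<in> A \<longleftrightarrow> y \<notin> A" if "{x, y} \<in> E" for x y
    using E[OF that] disj by (auto simp: doubleton_eq_iff)
  have wt_pos: "0 < wt W l x" for W l x
    using p by (auto simp: wt_def intro!: add_pos_nonneg sum_nonneg)
  have "(d / p) powr (p * card A) * C ^ card W * exp (p * (\<Sum>v\<in>B - W. l v))
      \<le> matching_sum E a (A \<union> W) (wt W l)"
    using finite_subset[OF W fin(2)] W
  proof (induction W arbitrary: l rule: finite_induct)
    case empty
    \<comment> \<open>Weight \<open>p / d\<close> on each of the \<open>d\<close> neighbours leaves
      \<open>1 - p\<close> for the constant; the shift by \<open>ln (d / p)\<close> cancels
      \<open>p / d\<close>, so that the mean is the weight of \<open>u\<close>.\<close>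
    have factor: "exp (p * ln (d / p) + p / d * (\<Sum>v | v \<in> B \<and> {u, v} \<in> E. l v)) \<le> wt {} l u"
      if u: "u \<in> A" for u
    proof -
      let ?N = "{v \<in> B. {u, v} \<in> E}"
      have w: "(\<Sum>v\<in>?N. p / d) = p" using regA[OF u] d by simp
      have "p * ln (d / p) + p / d * (\<Sum>v\<in>?N. l v) = (\<Sum>v\<in>?N. p / d * (l v + ln (d / p)))"
        using regA[OF u] d by (simp add: sum.distrib sum_distrib_left distrib_left)
      also have "exp \<dots> \<le> (1 - (\<Sum>v\<in>?N. p / d)) + (\<Sum>v\<in>?N. p / d * exp (l v + ln (d / p)))"
        by (rule weighted_exp_mean) (use w p d in \<open>simp_all del: sum_constant\<close>)
      also note w
      also have "(\<Sum>v\<in>?N. p / d * exp (l v + ln (d / p))) = (\<Sum>v\<in>?N. exp (l v))"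
        using p d by (simp add: exp_add)
      finally show ?thesis using u by (simp add: wt_def)
    qed
    \<comment> \<open>Each \<open>l v\<close> occurs in \<open>d\<close> of the factors, which
      cancels the \<open>1 / d\<close>.\<close>
    have "(\<Sum>u\<in>A. \<Sum>v | v \<in> B \<and> {u, v} \<in> E. l v) = (\<Sum>v\<in>B. \<Sum>u | u \<in> A \<and> {u, v} \<in> E. l v)"
      by (rule sum.swap_restrict[OF fin])
    also have "\<dots> = d * (\<Sum>v\<in>B. l v)"
      using regB by (simp add: sum_distrib_left)
    finally have "p * card A * ln (d / p) + p * (\<Sum>v\<in>B. l v) =
        (\<Sum>u\<in>A. p * ln (d / p) + p / d * (\<Sum>v | v \<in> B \<and> {u, v} \<in> E. l v))"
      using d by (simp add: sum.distrib flip: sum_distrib_left sum_divide_distrib)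
    then have "(d / p) powr (p * card A) * exp (p * (\<Sum>v\<in>B. l v)) =
        (\<Prod>u\<in>A. exp (p * ln (d / p) + p / d * (\<Sum>v | v \<in> B \<and> {u, v} \<in> E. l v)))"
      using p d fin by (simp add: powr_def flip: exp_add exp_sum)
    also have "\<dots> \<le> (\<Prod>u\<in>A. wt {} l u)"
      by (intro prod_mono conjI factor) simp_all
    also have "\<dots> = matching_sum E a (A \<union> {}) (wt {} l)"
      by (subst matching_sum_no_edges) (use E disj in fastforce)+
    finally show ?case by simp
  next
    case (insert v W)
    then have v: "v \<in> B" "v \<notin> A" and WB: "W \<subseteq> B" using disj by auto
    define c where "c = wt (insert v W) l"
    \<comment> \<open>\<open>\<delta>\<close> marks the neighbours of \<open>v\<close>, so
      \<open>f\<close> below restores the variable of \<open>v\<close> as the indeterminate. They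
      all lie in \<open>A\<close>, as \<open>matching_sum_roots\<close> requires.\<close>
    define \<delta> :: "'a \<Rightarrow> real" where "\<delta> x = (if {x, v} \<in> E then 1 else 0)" for x
    define f where "f = matching_sum E [:a:] (A \<union> W) (\<lambda>x. [:c x, \<delta> x:])"
    have finS: "finite (A \<union> W)" using fin insert by simp
    have \<delta>0: "\<delta> x = 0" if "x \<notin> A" for x
      using bip[of x v] that v by (auto simp: \<delta>_def)
    have \<delta>_nonneg: "0 \<le> \<delta> x" for x by (simp add: \<delta>_def)
    have nbr: "{x \<in> A \<union> W. {x, v} \<in> E} = {u \<in> A. {u, v} \<in> E}"
      using bip v by auto
    have f0: "coeff f 0 = matching_sum E a (A \<union> W) c"
      by (simp add: f_def poly_matching_sum flip: poly_0_coeff_0)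
    have f1: "coeff f 1 = (\<Sum>x | x \<in> A \<and> {x, v} \<in> E. matching_sum E a (A \<union> W - {x}) c)"
    proof -
      have "coeff f 1 = (\<Sum>x\<in>A \<union> W. if {x, v} \<in> E then matching_sum E a (A \<union> W - {x}) c else 0)"
        unfolding f_def coeff_1_matching_sum[OF finS] by (intro sum.cong) (auto simp: \<delta>_def)
      also have "\<dots> = (\<Sum>x | x \<in> A \<union> W \<and> {x, v} \<in> E. matching_sum E a (A \<union> W - {x}) c)"
        using finS by (simp only: sum.inter_filter)
      finally show ?thesis by (simp only: nbr)
    qed
    have pos: "0 < coeff f 0" "0 < coeff f 1"
    proof -
      show "0 < coeff f 0" unfolding f0 by (rule matching_sum_pos) (use finS a wt_pos in \<open>auto simp: c_def\<close>)
      have "{u \<in> A. {u, v} \<in> E} \<noteq> {}" using regB[OF v(1)] d by (metis card.empty less_irrefl)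
      then show "0 < coeff f 1" unfolding f1
        by (intro sum_pos matching_sum_pos) (use fin finS a wt_pos in \<open>auto simp: c_def\<close>)
    qed
    have "Polynomial.degree f \<le> card {x \<in> A \<union> W. \<delta> x \<noteq> 0}"
      unfolding f_def by (rule degree_matching_sum_le[OF finS])
    also have "{x \<in> A \<union> W. \<delta> x \<noteq> 0} = {u \<in> A. {u, v} \<in> E}"
      unfolding nbr[symmetric] by (auto simp: \<delta>_def)
    finally have deg: "Polynomial.degree f \<le> d" using regB[OF v(1)] by simp
    have roots: "z \<in> \<real> \<and> Re z < 0" if "poly (map_poly complex_of_real f) z = 0" for z
    proof (rule matching_sum_roots[where A = A])
      have "map_poly complex_of_real f = matching_sum E [:of_real a:] (A \<union> W) (\<lambda>x. [:of_real (c x), of_real (\<delta> x):])"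
        unfolding f_def by (rule map_poly_matching_sum)
      then show "matching_sum E (complex_of_real a) (A \<union> W)
          (\<lambda>x. complex_of_real (c x) + z * complex_of_real (\<delta> x)) = 0"
        using that by (simp add: poly_matching_sum)
    qed (use card2 finS a bip wt_pos \<delta>0 \<delta>_nonneg in \<open>auto simp: c_def\<close>)
    \<comment> \<open>The target bound without the factor \<open>C\<close> for \<open>v\<close>;
      restoring the variable of \<open>v\<close> as \<open>exp s\<close> multiplies it by
      \<open>exp (p * s)\<close>.\<close>
    define K where "K = (d / p) powr (p * card A) * C ^ card W * exp (p * (\<Sum>w\<in>B - insert v W. l w))"
    have "K * exp (p * s) \<le> poly f (exp s)" for s
    proof -
      have BW: "B - W = insert v (B - insert v W)" using v insert by auto
      have "K * exp (p * s) = (d / p) powr (p * card A) * C ^ card W *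
          exp (p * (\<Sum>w\<in>B - W. (l(v := s)) w))"
        unfolding K_def BW using fin by (simp add: exp_add distrib_left)
      \<comment> \<open>The induction hypothesis holds for every \<open>l\<close>, so the entry at
        \<open>v\<close> may be any \<open>s\<close>.\<close>
      also have "\<dots> \<le> matching_sum E a (A \<union> W) (wt W (l(v := s)))"
        by (rule insert.IH[OF WB])
      also have "\<dots> = poly f (exp s)"
        unfolding f_def poly_matching_sum
      proof (simp, rule matching_sum_cong)
        fix x assume x: "x \<in> A \<union> W"
        show "wt W (l(v := s)) x = c x + exp s * \<delta> x"
        proof (cases "x \<in> A")
          case True
          let ?N = "{w \<in> B - insert v W. {x, w} \<in> E}"
          have "{w \<in> B - W. {x, w} \<in> E} = (if {x, v} \<in> E then insert v ?N else ?N)"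
            using v insert by auto
          moreover have "(\<Sum>w\<in>?N. exp ((l(v := s)) w)) = (\<Sum>w\<in>?N. exp (l w))"
            by (intro sum.cong) auto
          ultimately show ?thesis using True fin by (simp add: wt_def c_def \<delta>_def)
        next
          case False
          then show ?thesis using \<delta>0 by (simp add: wt_def c_def)
        qed
      qed
      finally show ?thesis .
    qed
    then have "K * C \<le> (1 - p) * coeff f 0 + a * coeff f 1"
      unfolding C_def a_def using roots deg d pos p by (intro capacity_step) auto
    \<comment> \<open>The functional applied to \<open>f\<close> is the recursion at
      \<open>v\<close>: an uncovered \<open>v\<close> gives \<open>(1 - p) * coeff f 0\<close>, its
      possible partners give \<open>a * coeff f 1\<close>.\<close>
    also have "\<dots> = matching_sum E a (A \<union> insert v W) c"
    proof -
      have "matching_sum E a (A \<union> insert v W) c = c v * matching_sum E a (A \<union> insert v W - {v}) c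
        + a * (\<Sum>w | w \<in> A \<union> insert v W \<and> {v, w} \<in> E. matching_sum E a (A \<union> insert v W - {v, w}) c)"
        using finS by (intro matching_sum_recursion card2) auto
      moreover have "A \<union> insert v W - {v} = A \<union> W" using v insert by auto
      moreover have "A \<union> insert v W - {v, w} = A \<union> W - {w}" for w using v insert by auto
      moreover have "{w \<in> A \<union> insert v W. {v, w} \<in> E} = {u \<in> A. {u, v} \<in> E}"
        using bip v by (auto simp: insert_commute)
      moreover have "c v = 1 - p" using v by (simp add: c_def wt_def)
      ultimately show ?thesis by (simp only: f0 f1)
    qed
    also have "K * C = (d / p) powr (p * card A) * C ^ card (insert v W)
        * exp (p * (\<Sum>w\<in>B - insert v W. l w))"
      using insert by (simp add: K_def)
    finally show ?case by (simp add: c_def)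
  qed
  then show ?thesis by (simp add: C_def a_def wt_def[abs_def])
qed

section \<open>Regular bipartite graphs\<close>

text \<open>Matchings are sorted by size: \<open>k\<close> edges cover \<open>2 * k\<close> vertices
  and leave \<open>2 * (n - k)\<close> of weight \<open>b\<close>.\<close>

lemma matching_sum_const:
  assumes E: "\<And>e. e \<in> E \<Longrightarrow> card e = 2" "\<Union>E \<subseteq> V" and V: "finite V" "card V = 2 * n"
  shows "matching_sum E a V (\<lambda>_. b) = (\<Sum>k=0..n. of_nat (num_matchings E k) * a ^ k * b ^ (2 * (n - k)))"
proof -
  have card_Union: "card (\<Union>M) = 2 * card M" if "M \<in> matchings_in E V" for M
  proof -
    have "card (\<Union>M) = (\<Sum>e\<in>M. card e)"
      using that E card_ge_0_finite[of "_ :: 'a set"] by (intro card_Union_disjoint) (fastforce simp: matchings_in_def)+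
    also have "\<dots> = 2 * card M"
      using that E by (simp add: matchings_in_def subset_eq)
    finally show ?thesis .
  qed
  have card_le: "card M \<le> n" if "M \<in> matchings_in E V" for M
    using card_Union[OF that] V card_mono[of V "\<Union>M"] that by (simp add: matchings_in_def)
  have "matching_sum E a V (\<lambda>_. b) = (\<Sum>M\<in>matchings_in E V. a ^ card M * b ^ (2 * (n - card M)))"
    unfolding matching_sum_def
  proof (rule sum.cong)
    fix M assume M: "M \<in> matchings_in E V"
    then have "finite (\<Union>M)" "\<Union>M \<subseteq> V" using V by (auto simp: matchings_in_def intro: finite_subset)
    then have "card (V - \<Union>M) = 2 * (n - card M)"
      using card_Union[OF M] V by (simp add: card_Diff_subset diff_mult_distrib2)
    then show "a ^ card M * (\<Prod>x\<in>V - \<Union>M. b) = a ^ card M * b ^ (2 * (n - card M))" by simp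
  qed simp
  also have "\<dots> = (\<Sum>k=0..n. \<Sum>M | M \<in> matchings_in E V \<and> card M = k. a ^ card M * b ^ (2 * (n - card M)))"
    by (rule sum.group[symmetric]) (use V card_le in \<open>auto simp: finite_matchings_in\<close>)
  also have "\<dots> = (\<Sum>k=0..n. of_nat (num_matchings E k) * a ^ k * b ^ (2 * (n - k)))"
  proof (rule sum.cong)
    fix k
    have "{M \<in> matchings_in E V. card M = k} = matchings E k"
      using E(2) by (auto simp: matchings_in_def matchings_def)
    then show "(\<Sum>M | M \<in> matchings_in E V \<and> card M = k. a ^ card M * b ^ (2 * (n - card M)))
        = of_nat (num_matchings E k) * a ^ k * b ^ (2 * (n - k))"
      by (simp add: num_matchings_def mult.assoc matchings_def)
  qed simp
  finally show ?thesis .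
qed

text \<open>An edge at \<open>u\<close> is determined by its other end; this turns degrees into the
  neighbour counts of the elimination.\<close>

lemma card_neighbours:
  assumes "\<And>e. e \<in> E \<Longrightarrow> u \<in> e \<Longrightarrow> \<exists>v\<in>B. e = {u, v}"
  shows "card {v \<in> B. {u, v} \<in> E} = card {e \<in> E. u \<in> e}"
proof -
  have "{e \<in> E. u \<in> e} = (\<lambda>v. {u, v}) ` {v \<in> B. {u, v} \<in> E}"
    using assms by (auto simp: image_iff)
  moreover have "inj_on (\<lambda>v. {u, v}) {v \<in> B. {u, v} \<in> E}"
    by (auto simp: inj_on_def doubleton_eq_iff)
  ultimately show ?thesis by (simp add: card_image)
qed

text \<open>All variables are eliminated by taking \<open>W = B\<close>. The strict bounds on
  \<open>p\<close> keep \<open>d / p\<close> meaningful and the vertex weights \<open>1 - p\<close>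
  positive.\<close>

lemma matching_bound_interior:
  fixes V :: "'a set" and E :: "'a set set" and d n :: nat and p :: real
  assumes d: "d \<ge> 1" and G: "simple_graph V E" "bipartite V E" "regular d V E"
    and V: "card V = 2 * n" and p: "0 < p" "p < 1"
  shows "(\<Sum>k=0..n. real (num_matchings E k) * ((p / d) * (1 - p / d)) ^ k
            * (1 - p) ^ (2 * (n - k))) \<ge> (1 - p / d) ^ (n * d)"
proof -
  obtain A B where AB: "A \<union> B = V" "A \<inter> B = {}"
    and edges: "\<forall>e\<in>E. \<exists>u v. u \<in> A \<and> v \<in> B \<and> e = {u, v}"
    using G(2) unfolding bipartite_def by (elim exE conjE) (rule that)
  have E: "\<exists>u\<in>A. \<exists>v\<in>B. e = {u, v}" if "e \<in> E" for e
    using bspec[OF edges that] by (elim exE conjE) (intro bexI)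
  have fin: "finite A" "finite B" using G(1) AB by (auto simp: simple_graph_def)
  have deg: "card {e \<in> E. x \<in> e} = d" if "x \<in> A \<union> B" for x
    using G(3) that AB by (simp add: regular_def Defs.degree_def)
  have regA: "card {v \<in> B. {u, v} \<in> E} = d" if u: "u \<in> A" for u
  proof -
    have "\<exists>v\<in>B. e = {u, v}" if "e \<in> E" "u \<in> e" for e
      using E[OF that(1)] that(2) u AB(2) by (auto simp: disjoint_iff)
    then show ?thesis using card_neighbours[of E u B] deg[of u] u by simp
  qed
  have regB: "card {u \<in> A. {u, v} \<in> E} = d" if v: "v \<in> B" for v
  proof -
    have "\<exists>u\<in>A. e = {v, u}" if "e \<in> E" "v \<in> e" for e
      using E[OF that(1)] that(2) v AB(2) by (auto simp: disjoint_iff insert_commute)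
    then show ?thesis using card_neighbours[of E v A] deg[of v] v by (simp add: insert_commute)
  qed
  \<comment> \<open>Counting the edges from both sides gives colour classes of equal size, so the
    powers of \<open>d / p\<close> and \<open>p / d\<close> cancel.\<close>
  have "card A * d = (\<Sum>u\<in>A. \<Sum>v | v \<in> B \<and> {u, v} \<in> E. 1)" using regA by simp
  also have "\<dots> = (\<Sum>v\<in>B. \<Sum>u | u \<in> A \<and> {u, v} \<in> E. 1)" by (rule sum.swap_restrict[OF fin])
  also have "\<dots> = card B * d" using regB by simp
  finally have "card A = card B" using d by simp
  moreover have "card A + card B = 2 * n" using V AB fin card_Un_disjoint by metis
  ultimately have n: "card A = n" "card B = n" by auto
  have q: "((d / p) powr p) * (p / d) powr p = 1"
    using p d by (simp flip: powr_mult)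
  have "(1 - p / d) ^ (n * d) = ((d / p) powr p * (p / d) powr p * (1 - p / d) ^ d) ^ n"
    unfolding q by (simp add: mult.commute flip: power_mult)
  also have "\<dots> = (d / p) powr (p * card A) * ((1 - p / d) ^ d * (p / d) powr p) ^ card B
      * exp (p * (\<Sum>v\<in>B - B. 0))"
    using p d by (simp add: n power_mult_distrib mult_ac flip: powr_powr powr_realpow)
  \<comment> \<open>No variable is left, so \<open>l\<close> can be constantly 0.\<close>
  also have "\<dots> \<le> matching_sum E (p / d * (1 - p / d)) (A \<union> B)
      (\<lambda>x. 1 - p + (if x \<in> A then \<Sum>v | v \<in> B - B \<and> {x, v} \<in> E. exp 0 else 0))"
    by (rule matching_sum_capacity[OF fin AB(2) E regA regB]) (use d p in simp_all)
  also have "\<dots> = matching_sum E (p / d * (1 - p / d)) (A \<union> B) (\<lambda>_. 1 - p)"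
    by (rule matching_sum_cong) simp
  also have "\<dots> = (\<Sum>k=0..n. real (num_matchings E k) * ((p / d) * (1 - p / d)) ^ k
            * (1 - p) ^ (2 * (n - k)))"
  proof (rule matching_sum_const)
    show "card e = 2" if "e \<in> E" for e using E[OF that] AB by (auto simp: card_insert_if)
    show "\<Union>E \<subseteq> A \<union> B" using E by fastforce
  qed (use fin V AB in auto)
  finally show ?thesis .
qed

theorem theorem1p6:
  fixes V :: "'a set" and E :: "'a set set" and d n :: nat and p :: real
  assumes "d \<ge> 1"
    and "simple_graph V E" and "bipartite V E" and "regular d V E"
    and "card V = 2 * n"
    and "0 \<le> p" and "p \<le> 1"
  shows "(\<Sum>k=0..n. real (num_matchings E k) * ((p / d) * (1 - p / d)) ^ k
            * (1 - p) ^ (2 * (n - k))) \<ge> (1 - p / d) ^ (n * d)"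
proof -
  \<comment> \<open>With \<open>0 ^ 0 = 1\<close> this is a polynomial function on the whole line,
    so its sign at 0 and 1 follows from one-sided limits.\<close>
  define F where "F x = (\<Sum>k=0..n. real (num_matchings E k) * ((x / d) * (1 - x / d)) ^ k
            * (1 - x) ^ (2 * (n - k))) - (1 - x / d) ^ (n * d)" for x :: real
  have interior: "0 \<le> F x" if "0 < x" "x < 1" for x
    using matching_bound_interior[OF assms(1-5) that] by (simp add: F_def)
  have cont: "isCont F x" for x
    unfolding F_def using assms(1) by (intro continuous_intros) auto
  consider "p = 0" | "p = 1" | "0 < p" "p < 1" using assms by linarith
  then have "0 \<le> F p"
  proof cases
    case 1
    have "(F \<longlongrightarrow> F 0) (at_right 0)"
      using cont[of 0] by (auto simp: isCont_def intro: filterlim_mono at_le)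
    moreover have "eventually (\<lambda>x. 0 \<le> F x) (at_right 0)"
      unfolding eventually_at_right_field using interior by (intro exI[of _ 1]) auto
    ultimately show ?thesis using 1 by (simp add: tendsto_lowerbound)
  next
    case 2
    have "(F \<longlongrightarrow> F 1) (at_left 1)"
      using cont[of 1] by (auto simp: isCont_def intro: filterlim_mono at_le)
    moreover have "eventually (\<lambda>x. 0 \<le> F x) (at_left 1)"
      unfolding eventually_at_left_field using interior by (intro exI[of _ 0]) auto
    ultimately show ?thesis using 2 by (simp add: tendsto_lowerbound)
  qed (use interior in simp)
  then show ?thesis by (simp add: F_def)
qed

end
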